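(* For every integer $n\ge2$, the infimum defining $\Delta(n)$ is attained: there is a dissection $D_0\in\mathcal D_n$ with $R(D_0)=\Delta(n)$. In particular, $$\Delta(n)=\min_{D\in\mathcal D_n}R(D),$$ where $\mathcal D_n$ denotes the space of all (genuine) dissections of the unit square into $n$ nondegenerate triangles.
   Context: A (genuine) dissection of the unit square $[0,1]^2$ into $n$ triangles is a collection of $n$ nondegenerate (positive-area) closed triangles with pairwise disjoint interiors whose union is the square. It need not be a simplicial triangulation: T-junctions are allowed, i.e. a vertex of one triangle may lie in the relative interior of a side of another triangle. If $D$ is a dissection whose triangles have areas $a_1,\dots,a_n$, its area range is $R(D)=\max_i a_i-\min_i a_i$, and $\Delta(n)=\inf_{D} R(D)$, the infimum over all dissections of the unit square into $n$ nondegenerate triangles. *)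

theory Defs
  imports "HOL-Analysis.Analysis"
begin

definition unit_square :: "(real^2) set" where
  "unit_square = cbox 0 1"

definition area :: "(real^2) set \<Rightarrow> real" where
  "area S = measure lebesgue S"

definition nondegenerate_triangle :: "(real^2) set \<Rightarrow> bool" where
  "nondegenerate_triangle T \<longleftrightarrow> (\<exists>a b c. T = convex hull {a, b, c}) \<and> area T > 0"

(* Triangles have nonempty, pairwise disjoint interiors, so an unordered collection of n of them
   is the same as a set of cardinality n.  Nothing is required of how their sides meet:
   T-junctions are allowed. *)
definition dissections :: "nat \<Rightarrow> (real^2) set set set" where
  "dissections n = {D. finite D \<and> card D = n \<and>
      (\<forall>T\<in>D. nondegenerate_triangle T) \<and>
      pairwise (\<lambda>S T. interior S \<inter> interior T = {}) D \<and>
      \<Union>D = unit_square}"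

definition area_range :: "(real^2) set set \<Rightarrow> real" where
  "area_range D = Max (area ` D) - Min (area ` D)"

definition Delta :: "nat \<Rightarrow> real" where
  "Delta n = (INF D\<in>dissections n. area_range D)"

end

theory Submission
  imports Defs
begin

text \<open>
  For triangles contained in the square and covering it, disjointness of interiors is the
  same as their areas summing to 1; covering and area sum both survive passing to a limit of vertices.
  Hence a minimizing sequence of dissections has a limit which, once its degenerate triangles are
  discarded, is a dissection. If none were degenerate, it attains the infimum. Otherwise the
  smallest areas tend to 0, so no triangle of the limit has area exceeding \<open>Delta n\<close>.
  Cutting triangles along medians until there are \<open>n\<close> of them again
  yields areas in \<open>{0<..Delta n}\<close>, so a range strictly below the infimum, which is absurd.
\<close>

section \<open>Areas and the unit square\<close>

lemma area_triangle:
  fixes a b c :: "real^2"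
  shows "area (convex hull {a, b, c}) =
    \<bar>(c $ 1 - a $ 1) * (b $ 2 - a $ 2) - (b $ 1 - a $ 1) * (c $ 2 - a $ 2)\<bar> / 2"
proof -
  have "compact (convex hull {a, b, c})"
    by (simp add: finite_imp_compact_convex_hull)
  then have "convex hull {a, b, c} \<in> sets lborel"
    by (simp add: borel_compact)
  then show ?thesis
    unfolding area_def by (simp add: content_triangle)
qed

lemma triangle_lmeasurable:
  fixes a b c :: "'a::euclidean_space"
  shows "convex hull {a, b, c} \<in> lmeasurable"
  by (simp add: finite_imp_compact_convex_hull lmeasurable_compact)

lemma area_nonneg: "0 \<le> area S"
  by (simp add: area_def)

lemma unit_square_altdef: "unit_square = {x. 0 \<le> x $ 1 \<and> x $ 1 \<le> 1 \<and> 0 \<le> x $ 2 \<and> x $ 2 \<le> 1}"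
  by (auto simp: unit_square_def cbox_def Basis_vec_def inner_axis forall_2)

lemma area_unit_square: "area unit_square = 1"
proof -
  have "(\<Prod>b\<in>Basis. (1 - 0 :: real^2) \<bullet> b) = 1"
    by (rule prod.neutral) (auto simp: Basis_vec_def inner_axis)
  moreover have "(0::real^2) \<bullet> b \<le> 1 \<bullet> b" if "b \<in> Basis" for b
    using that by (auto simp: Basis_vec_def inner_axis)
  ultimately show ?thesis
    by (simp add: area_def unit_square_def content_cbox)
qed

text \<open>A missed point has an open neighbourhood avoiding \<open>C\<close>. The square is convex
  with nonempty interior, so each of its points is a limit of interior points; hence that
  neighbourhood meets the interior in a nonempty open set, which cannot be negligible.\<close>

lemma closed_subset_unit_square_full:
  assumes "closed C" "C \<subseteq> unit_square" "negligible (unit_square - C)"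
  shows "C = unit_square"
proof (rule ccontr)
  assume "C \<noteq> unit_square"
  then obtain x where x: "x \<in> unit_square" "x \<notin> C"
    using assms by blast
  \<comment> \<open>A convex set with empty interior is negligible, whereas the square has area
    1.\<close>
  have "interior unit_square \<noteq> {}"
    using area_unit_square negligible_convex_interior[of unit_square]
      negligible_imp_measure0[of unit_square]
    by (auto simp: area_def unit_square_def)
  then have "x \<in> closure (interior unit_square)"
    using x convex_closure_interior[of unit_square]
    by (simp add: unit_square_def closure_closed)
  moreover have "open (- C)" "x \<in> - C"
    using assms x by auto
  ultimately have "- C \<inter> interior unit_square \<noteq> {}"
    by (meson disjoint_iff open_Int_closure_eq_empty IntI)
  moreover have "open (- C \<inter> interior unit_square)"
    using assms by auto
  moreover have "negligible (- C \<inter> interior unit_square)"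
    using assms(3) by (rule negligible_subset) (use interior_subset in auto)
  ultimately show False
    using open_not_negligible by blast
qed

section \<open>Dissections as coverings of total area 1\<close>

text \<open>Convexity turns disjoint interiors into negligible overlaps: \<open>S \<inter> T\<close>
  is convex with empty interior. Measure is then additive over the union.\<close>

lemma sum_area_dissection:
  assumes "D \<in> dissections n"
  shows "(\<Sum>T\<in>D. area T) = 1"
proof -
  have D: "finite D" "\<And>T. T \<in> D \<Longrightarrow> nondegenerate_triangle T"
    "pairwise (\<lambda>S T. interior S \<inter> interior T = {}) D" "\<Union>D = unit_square"
    using assms by (auto simp: dissections_def)
  have "measure lebesgue (\<Union>D) = (\<Sum>T\<in>D. measure lebesgue T)"
  proof (rule measure_negligible_finite_Union)
    show "finite D" by fact
    show "T \<in> lmeasurable" if "T \<in> D" for T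
      using D(2)[OF that] triangle_lmeasurable by (auto simp: nondegenerate_triangle_def)
    show "pairwise (\<lambda>S T. negligible (S \<inter> T)) D"
    proof (rule pairwiseI)
      fix S T assume *: "S \<in> D" "T \<in> D" "S \<noteq> T"
      then have "convex (S \<inter> T)"
        using D(2) by (auto simp: nondegenerate_triangle_def intro!: convex_Int)
      moreover have "interior (S \<inter> T) = {}"
        using D(3) * by (simp add: pairwise_def)
      ultimately show "negligible (S \<inter> T)"
        by (simp add: negligible_convex_interior)
    qed
  qed
  then show ?thesis
    using D(4) area_unit_square by (simp add: area_def)
qed

text \<open>Covering the square already costs total area at least 1, so a sum of at most 1 leaves
  nothing for overlaps. The family is indexed so that repeated and degenerate members may occur a
  priori. Every dissection constructed below is certified by this criterion.\<close>

lemma dissection_of_cover: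
  fixes F :: "'i \<Rightarrow> (real^2) set"
  assumes fin: "finite I"
    and tri: "\<And>i. i \<in> I \<Longrightarrow> \<exists>a b c. F i = convex hull {a, b, c}"
    and sub: "\<And>i. i \<in> I \<Longrightarrow> F i \<subseteq> unit_square"
    and cover: "unit_square \<subseteq> (\<Union>i\<in>I. F i)"
    and sum: "(\<Sum>i\<in>I. area (F i)) \<le> 1"
  defines "J \<equiv> {i \<in> I. 0 < area (F i)}"
  shows "F ` J \<in> dissections (card J)"
proof -
  have meas: "F i \<in> lmeasurable" if "i \<in> I" for i
    using tri[OF that] triangle_lmeasurable by auto
  have clo: "closed (F i)" if "i \<in> I" for i
    using tri[OF that] by (auto simp: finite_imp_compact_convex_hull compact_imp_closed)
  have negl: "negligible (F i \<inter> F j)" if ij: "i \<in> I" "j \<in> I" "i \<noteq> j" for i j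
  proof -
    let ?K = "I - {i, j}"
    have m: "F i \<union> F j \<in> lmeasurable" "(\<Union>k\<in>?K. F k) \<in> lmeasurable"
      using meas ij fin by (auto intro!: fmeasurable.finite_UN)
    \<comment> \<open>Inclusion-exclusion on the chosen pair and subadditivity for the rest give
      that 1 is at most the total sum minus the overlap of \<open>F i\<close> and
      \<open>F j\<close>.\<close>
    have "1 \<le> area ((F i \<union> F j) \<union> (\<Union>k\<in>?K. F k))"
      unfolding area_unit_square[symmetric] area_def
      by (rule measure_mono_fmeasurable)
        (use cover m in \<open>auto simp: unit_square_def\<close>)
    also have "\<dots> \<le> area (F i \<union> F j) + area (\<Union>k\<in>?K. F k)"
      unfolding area_def by (rule measure_Un_le) (use m in auto)
    also have "area (F i \<union> F j) = area (F i) + area (F j) - area (F i \<inter> F j)"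
      unfolding area_def by (rule measure_Un3) (use meas ij in auto)
    also have "area (\<Union>k\<in>?K. F k) \<le> (\<Sum>k\<in>?K. area (F k))"
      unfolding area_def by (rule measure_UNION_le) (use fin meas in auto)
    also have "(\<Sum>k\<in>?K. area (F k)) = (\<Sum>k\<in>I. area (F k)) - (area (F i) + area (F j))"
      using fin ij by (simp add: sum_diff)
    finally have "area (F i \<inter> F j) \<le> 0"
      using sum by simp
    then have "measure lebesgue (F i \<inter> F j) = 0"
      by (simp add: area_def measure_le_0_iff)
    then show ?thesis
      using meas ij by (simp add: negligible_iff_measure0 fmeasurable.Int)
  qed
  have J: "J \<subseteq> I" "finite J"
    using fin by (auto simp: J_def)
  \<comment> \<open>Equal triangles at distinct indices would overlap in all of \<open>F i\<close>,
    whose area is positive on \<open>J\<close>.\<close>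
  have "inj_on F J"
  proof (rule inj_onI, rule ccontr)
    fix i j assume *: "i \<in> J" "j \<in> J" "F i = F j" "i \<noteq> j"
    then have "negligible (F i)"
      using negl[of i j] J by auto
    then show False
      using * by (auto simp: J_def area_def dest: negligible_imp_measure0)
  qed
  moreover have "pairwise (\<lambda>S T. interior S \<inter> interior T = {}) (F ` J)"
  proof (rule pairwise_imageI)
    fix i j assume "i \<in> J" "j \<in> J" "i \<noteq> j"
    then have "negligible (F i \<inter> F j)"
      using negl J by auto
    then have "negligible (interior (F i \<inter> F j))"
      by (rule negligible_subset) (rule interior_subset)
    then show "interior (F i) \<inter> interior (F j) = {}"
      using open_not_negligible[of "interior (F i \<inter> F j)"] by auto
  qed
  \<comment> \<open>Dropping the degenerate triangles uncovers at most a negligible set; as the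
    remaining union is closed, it uncovers nothing.\<close>
  moreover have "\<Union>(F ` J) = unit_square"
  proof (rule closed_subset_unit_square_full)
    show "closed (\<Union>(F ` J))"
      using J clo by auto
    show "\<Union>(F ` J) \<subseteq> unit_square"
      using sub J by auto
    have "negligible (\<Union>i\<in>I - J. F i)"
    proof (rule negligible_Union)
      fix T assume "T \<in> F ` (I - J)"
      then obtain i where i: "i \<in> I" "\<not> 0 < area (F i)" "T = F i"
        by (auto simp: J_def)
      then have "measure lebesgue (F i) = 0"
        by (simp add: area_def not_less measure_le_0_iff)
      then show "negligible T"
        using meas i by (simp add: negligible_iff_measure0)
    qed (use fin in auto)
    then show "negligible (unit_square - \<Union>(F ` J))"
      by (rule negligible_subset) (use cover in auto)
  qed
  ultimately show ?thesis
    using J tri by (auto simp: dissections_def card_image nondegenerate_triangle_def J_def)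
qed

section \<open>Median cuts, refinement, and existence of dissections\<close>

text \<open>The larger of the barycentric weights at \<open>b\<close> and \<open>c\<close> tells on
  which side of the median from \<open>a\<close> a point lies. The smaller weight, taken from both
  vertices, is moved with factor 2 to the midpoint.\<close>

lemma triangle_median_split:
  fixes a b c :: "'a::real_vector"
  shows "convex hull {a, b, c} =
    convex hull {a, b, midpoint b c} \<union> convex hull {a, midpoint b c, c}" (is "?T = ?S \<union> ?U")
proof
  have "midpoint b c \<in> convex hull {b, c}"
    by (simp add: midpoint_def convex_hull_2)
      (metis add.commute divide_nonneg_pos field_sum_of_halves inverse_eq_divide
        pos_le_divide_eq scaleR_right_distrib zero_le_one zero_less_numeral)
  then have m: "midpoint b c \<in> ?T"
    using hull_mono[of "{b, c}" "{a, b, c}" convex] by auto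
  show "?S \<union> ?U \<subseteq> ?T"
    using m by (intro Un_least hull_minimal) (auto intro: hull_inc)
  show "?T \<subseteq> ?S \<union> ?U"
  proof
    fix x assume "x \<in> ?T"
    then obtain u v w where x: "0 \<le> u" "0 \<le> v" "0 \<le> w" "u + v + w = 1"
      "x = u *\<^sub>R a + v *\<^sub>R b + w *\<^sub>R c"
      by (auto simp: convex_hull_3)
    show "x \<in> ?S \<union> ?U"
    proof (cases "w \<le> v")
      case True
      have "x = u *\<^sub>R a + (v - w) *\<^sub>R b + (2 * w) *\<^sub>R midpoint b c"
        by (simp add: x midpoint_def algebra_simps)
      then have "x \<in> ?S"
        unfolding convex_hull_3 using x True
        by (intro CollectI exI[of _ u] exI[of _ "v - w"] exI[of _ "2 * w"]) auto
      then show ?thesis ..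
    next
      case False
      have "x = u *\<^sub>R a + (2 * v) *\<^sub>R midpoint b c + (w - v) *\<^sub>R c"
        by (simp add: x midpoint_def algebra_simps)
      then have "x \<in> ?U"
        unfolding convex_hull_3 using x False
        by (intro CollectI exI[of _ u] exI[of _ "2 * v"] exI[of _ "w - v"]) auto
      then show ?thesis ..
    qed
  qed
qed

lemma area_median_split:
  fixes a b c :: "real^2"
  shows "area (convex hull {a, b, midpoint b c}) = area (convex hull {a, b, c}) / 2"
    and "area (convex hull {a, midpoint b c, c}) = area (convex hull {a, b, c}) / 2"
proof -
  have m: "midpoint b c $ i = (b $ i + c $ i) / 2" for i
    by (simp add: midpoint_def)
  let ?X = "(c $ 1 - a $ 1) * (b $ 2 - a $ 2) - (b $ 1 - a $ 1) * (c $ 2 - a $ 2)"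
  have 1: "(midpoint b c $ 1 - a $ 1) * (b $ 2 - a $ 2) - (b $ 1 - a $ 1) * (midpoint b c $ 2 - a $ 2) = ?X / 2"
    unfolding m by (simp add: field_simps)
  show "area (convex hull {a, b, midpoint b c}) = area (convex hull {a, b, c}) / 2"
    by (simp only: area_triangle 1) simp
  have 2: "(c $ 1 - a $ 1) * (midpoint b c $ 2 - a $ 2) - (midpoint b c $ 1 - a $ 1) * (c $ 2 - a $ 2) = ?X / 2"
    unfolding m by (simp add: field_simps)
  show "area (convex hull {a, midpoint b c, c}) = area (convex hull {a, b, c}) / 2"
    by (simp only: area_triangle 2) simp
qed

text \<open>Halving one triangle by a median raises the count by one and keeps any upper bound on
  the areas. Since the total area is unchanged, the covering criterion supplies disjointness of
  interiors.\<close>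

lemma dissection_refine_Suc:
  assumes D: "D \<in> dissections n" and le: "\<And>T. T \<in> D \<Longrightarrow> area T \<le> M"
  shows "\<exists>D'\<in>dissections (Suc n). \<forall>T\<in>D'. area T \<le> M"
proof -
  have D': "finite D" "card D = n" "\<And>T. T \<in> D \<Longrightarrow> nondegenerate_triangle T"
    "\<Union>D = unit_square"
    using D by (auto simp: dissections_def)
  have "D \<noteq> {}"
    using sum_area_dissection[OF D] by auto
  then obtain T where T: "T \<in> D" by blast
  then obtain a b c where abc: "T = convex hull {a, b, c}" "area T > 0"
    using D'(3)[OF T] unfolding nondegenerate_triangle_def by blast
  define S where "S = convex hull {a, b, midpoint b c}"
  define U where "U = convex hull {a, midpoint b c, c}"
  have TSU: "T = S \<union> U"
    unfolding S_def U_def abc by (rule triangle_median_split)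
  have half: "area S = area T / 2" "area U = area T / 2"
    unfolding S_def U_def abc by (rule area_median_split)+
  \<comment> \<open>The option type adds one fresh index to \<open>D\<close>: \<open>None\<close>
    carries the half \<open>S\<close>, and the index of \<open>T\<close> itself now carries the half
    \<open>U\<close>.\<close>
  define F where "F x = (case x of None \<Rightarrow> S | Some X \<Rightarrow> if X = T then U else X)" for x
  define I where "I = insert None (Some ` D)"
  have F_cases: "F x = S \<or> F x = U \<or> F x \<in> D" if "x \<in> I" for x
    using that by (cases x) (simp_all add: F_def I_def image_iff)
  have pos: "0 < area (F x)" if "x \<in> I" for x
    using that half abc D'(3) by (auto simp: F_def I_def nondegenerate_triangle_def)
  have "(\<Sum>x\<in>I. area (F x)) = area S + (\<Sum>X\<in>D. area (if X = T then U else X))"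
    unfolding I_def using D' by (subst sum.insert) (auto simp: sum.reindex F_def)
  also have "\<dots> = area S + (area U + (\<Sum>X\<in>D - {T}. area X))"
    using D' T by (simp add: sum.remove[of D T])
  also have "\<dots> = 1"
    using sum_area_dissection[OF D] D' T half by (simp add: sum.remove[of D T])
  finally have sum: "(\<Sum>x\<in>I. area (F x)) = 1" .
  have "F ` {x \<in> I. 0 < area (F x)} \<in> dissections (card {x \<in> I. 0 < area (F x)})"
  proof (rule dissection_of_cover)
    show "\<exists>a b c. F x = convex hull {a, b, c}" if "x \<in> I" for x
      using F_cases[OF that] D'(3) unfolding S_def U_def nondegenerate_triangle_def by blast
    show "F x \<subseteq> unit_square" if "x \<in> I" for x
      using F_cases[OF that] TSU T D'(4) by blast
    show "unit_square \<subseteq> (\<Union>x\<in>I. F x)"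
    proof
      fix p assume "p \<in> unit_square"
      then obtain X where X: "X \<in> D" "p \<in> X"
        using D' by blast
      show "p \<in> (\<Union>x\<in>I. F x)"
      proof (cases "X = T")
        case True
        then show ?thesis
          using X T TSU by (auto simp: F_def I_def)
      next
        case False
        then show ?thesis
          using X by (auto simp: F_def I_def intro!: bexI[of _ X])
      qed
    qed
  qed (use D' sum in \<open>auto simp: I_def\<close>)
  moreover have "{x \<in> I. 0 < area (F x)} = I"
    using pos by auto
  moreover have "card I = Suc n"
    unfolding I_def using D' by (subst card_insert_disjoint) (auto simp: card_image)
  moreover have "area (F x) \<le> M" if "x \<in> I" for x
    using that le le[OF T] abc(2) half by (auto simp: F_def I_def)
  ultimately show ?thesis
    by (intro bexI[of _ "F ` I"]) auto
qed

lemma dissection_refine: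
  assumes "m \<le> n" "D \<in> dissections m" "\<And>T. T \<in> D \<Longrightarrow> area T \<le> M"
  shows "\<exists>D'\<in>dissections n. \<forall>T\<in>D'. area T \<le> M"
  using assms(1)
proof (induction n rule: dec_induct)
  case base
  then show ?case using assms by blast
next
  case (step k)
  then show ?case using dissection_refine_Suc by blast
qed

text \<open>The diagonal from \<open>0\<close> to \<open>1\<close> cuts the square into two
  triangles of area 1/2; comparing the two coordinates of a point decides which one contains
  it.\<close>

lemma dissections_2_nonempty: "dissections 2 \<noteq> {}"
proof -
  define e1 e2 where "e1 = (vector [1, 0] :: real^2)" and "e2 = (vector [0, 1] :: real^2)"
  define F where "F k = (if k then convex hull {0, e1, 1} else convex hull {0, e2, 1})" for k
  have area: "area (F k) = 1 / 2" for k
    by (cases k) (simp_all add: F_def area_triangle e1_def e2_def)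
  have "F ` {k \<in> UNIV. 0 < area (F k)} \<in> dissections (card {k \<in> UNIV. 0 < area (F k)})"
  proof (rule dissection_of_cover)
    show "\<exists>a b c. F k = convex hull {a, b, c}" for k
      by (auto simp: F_def)
    show "F k \<subseteq> unit_square" for k
    proof -
      have "convex unit_square"
        by (simp add: unit_square_def)
      moreover have "{0, e1, 1} \<subseteq> unit_square" "{0, e2, 1} \<subseteq> unit_square"
        by (simp_all add: e1_def e2_def unit_square_altdef)
      ultimately show ?thesis
        unfolding F_def by (simp add: hull_minimal)
    qed
    show "(\<Sum>k\<in>UNIV. area (F k)) \<le> 1"
      by (simp add: area UNIV_bool)
    show "unit_square \<subseteq> (\<Union>k\<in>UNIV. F k)"
    proof
      fix x :: "real^2"
      assume "x \<in> unit_square"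
      then have x: "0 \<le> x $ 1" "x $ 1 \<le> 1" "0 \<le> x $ 2" "x $ 2 \<le> 1"
        by (auto simp: unit_square_altdef)
      show "x \<in> (\<Union>k\<in>UNIV. F k)"
      proof (cases "x $ 2 \<le> x $ 1")
        case True
        have "x = (1 - x $ 1) *\<^sub>R 0 + (x $ 1 - x $ 2) *\<^sub>R e1 + (x $ 2) *\<^sub>R 1"
          by (simp add: vec_eq_iff forall_2 e1_def)
        then have "x \<in> F True"
          unfolding F_def convex_hull_3 if_True using x True
          by (intro CollectI exI[of _ "1 - x $ 1"] exI[of _ "x $ 1 - x $ 2"] exI[of _ "x $ 2"]) auto
        then show ?thesis by blast
      next
        case False
        have "x = (1 - x $ 2) *\<^sub>R 0 + (x $ 2 - x $ 1) *\<^sub>R e2 + (x $ 1) *\<^sub>R 1"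
          by (simp add: vec_eq_iff forall_2 e2_def)
        then have "x \<in> F False"
          unfolding F_def convex_hull_3 if_False using x False
          by (intro CollectI exI[of _ "1 - x $ 2"] exI[of _ "x $ 2 - x $ 1"] exI[of _ "x $ 1"]) auto
        then show ?thesis by blast
      qed
    qed
  qed auto
  then show ?thesis
    by (auto simp: area)
qed

section \<open>Limits of triangles\<close>

text \<open>Sequential compactness is applied to one index at a time; each further subsequence
  preserves the limits already obtained.\<close>

lemma compact_finite_family_convergent_subseq:
  fixes f :: "nat \<Rightarrow> 'i \<Rightarrow> 'a::metric_space"
  assumes "finite I" "compact K" "\<And>k i. i \<in> I \<Longrightarrow> f k i \<in> K"
  shows "\<exists>r l. strict_mono (r :: nat \<Rightarrow> nat) \<and> (\<forall>i\<in>I. l i \<in> K \<and> (\<lambda>k. f (r k) i) \<longlonglongrightarrow> l i)"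
  using assms(1,3)
proof (induction I rule: finite_induct)
  case empty
  show ?case by (auto intro!: exI[of _ id] simp: strict_mono_def)
next
  case (insert j I)
  then obtain r l where r: "strict_mono r" "\<forall>i\<in>I. l i \<in> K \<and> (\<lambda>k. f (r k) i) \<longlonglongrightarrow> l i"
    by blast
  have "\<forall>k. f (r k) j \<in> K"
    using insert by auto
  then obtain x s where s: "x \<in> K" "strict_mono s" "((\<lambda>k. f (r k) j) \<circ> s) \<longlonglongrightarrow> x"
    using \<open>compact K\<close> unfolding compact_def by meson
  have "(l(j := x)) i \<in> K \<and> (\<lambda>k. f ((r \<circ> s) k) i) \<longlonglongrightarrow> (l(j := x)) i"
    if "i \<in> insert j I" for i
  proof (cases "i = j")
    case True
    then show ?thesis using s by (simp add: o_def)
  next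
    case False
    then have "((\<lambda>k. f (r k) i) \<circ> s) \<longlonglongrightarrow> l i"
      using that r s by (intro LIMSEQ_subseq_LIMSEQ) auto
    then show ?thesis using False that r by (simp add: o_def)
  qed
  moreover have "strict_mono (r \<circ> s)"
    using r s by (simp add: strict_mono_o)
  ultimately show ?case
    by blast
qed

text \<open>A hyperplane strictly separating \<open>x\<close> from the limit triangle still has all
  three vertices on its far side after a small perturbation, hence the whole perturbed triangle.
  This is what makes coverings survive in the limit.\<close>

lemma eventually_notin_triangle:
  fixes a b c :: "'a::euclidean_space"
  assumes lim: "(f \<longlongrightarrow> a) net" "(g \<longlongrightarrow> b) net" "(h \<longlongrightarrow> c) net"
    and x: "x \<notin> convex hull {a, b, c}"
  shows "eventually (\<lambda>k. x \<notin> convex hull {f k, g k, h k}) net"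
proof -
  have "closed (convex hull {a, b, c})"
    by (simp add: finite_imp_compact_convex_hull compact_imp_closed)
  then obtain z t where z: "z \<bullet> x < t" "\<forall>y\<in>convex hull {a, b, c}. z \<bullet> y > t"
    using separating_hyperplane_closed_point[OF convex_convex_hull _ x] by blast
  then have "t < z \<bullet> a" "t < z \<bullet> b" "t < z \<bullet> c"
    by (auto simp: hull_inc)
  then have "eventually (\<lambda>k. t < z \<bullet> f k) net" "eventually (\<lambda>k. t < z \<bullet> g k) net"
    "eventually (\<lambda>k. t < z \<bullet> h k) net"
    by (auto intro!: order_tendstoD(1)[OF tendsto_inner[OF tendsto_const]] lim)
  then show ?thesis
  proof eventually_elim
    case (elim k)
    then have "convex hull {f k, g k, h k} \<subseteq> {y. z \<bullet> y > t}"
      by (intro hull_minimal) (auto simp: convex_halfspace_gt)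
    then show ?case using z by auto
  qed
qed

lemma tendsto_area_triangle:
  fixes a b c :: "real^2"
  assumes "(f \<longlongrightarrow> a) net" "(g \<longlongrightarrow> b) net" "(h \<longlongrightarrow> c) net"
  shows "((\<lambda>k. area (convex hull {f k, g k, h k})) \<longlongrightarrow> area (convex hull {a, b, c})) net"
  unfolding area_triangle by (intro tendsto_intros assms) auto

section \<open>The area range and minimizing sequences\<close>

lemma area_diff_le_area_range:
  assumes "finite D" "S \<in> D" "T \<in> D"
  shows "area S - area T \<le> area_range D"
proof -
  have "area S \<le> Max (area ` D)" "Min (area ` D) \<le> area T"
    using assms by auto
  then show ?thesis by (simp add: area_range_def)
qed

lemma area_range_attained:
  assumes "finite D" "D \<noteq> {}"
  obtains S T where "S \<in> D" "T \<in> D" "area_range D = area S - area T"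
proof -
  have "Max (area ` D) \<in> area ` D" "Min (area ` D) \<in> area ` D"
    using assms by (intro Max_in Min_in; simp)+
  then show ?thesis
    using that by (auto simp: area_range_def)
qed

lemma dissection_finite_nonempty:
  assumes "D \<in> dissections n"
  shows "finite D" "D \<noteq> {}"
  using assms sum_area_dissection[OF assms] by (auto simp: dissections_def)

lemma Delta_le_area_range:
  assumes "D \<in> dissections n"
  shows "Delta n \<le> area_range D"
  unfolding Delta_def
proof (rule cINF_lower)
  have "0 \<le> area_range E" if "E \<in> dissections n" for E
    using dissection_finite_nonempty[OF that] area_diff_le_area_range[of E] by fastforce
  then show "bdd_below (area_range ` dissections n)"
    by (auto intro!: bdd_belowI[of _ 0])
qed fact

lemma minimizing_sequence:
  assumes "dissections n \<noteq> {}"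
  obtains D where "\<And>k::nat. D k \<in> dissections n" "(\<lambda>k. area_range (D k)) \<longlonglongrightarrow> Delta n"
proof -
  have "\<exists>D\<in>dissections n. area_range D < Delta n + inverse (real (Suc k))" for k
  proof (rule ccontr)
    assume "\<not> ?thesis"
    then have "Delta n + inverse (real (Suc k)) \<le> Delta n"
      unfolding Delta_def using assms by (intro cINF_greatest) (auto simp: not_less Delta_def)
    then show False by simp
  qed
  then obtain D where D: "\<And>k. D k \<in> dissections n"
    "\<And>k. area_range (D k) < Delta n + inverse (real (Suc k))"
    by metis
  have "(\<lambda>k. Delta n + inverse (real (Suc k))) \<longlonglongrightarrow> Delta n"
    using LIMSEQ_inverse_real_of_nat_add by blast
  then have "(\<lambda>k. area_range (D k)) \<longlonglongrightarrow> Delta n"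
    by (rule tendsto_sandwich[OF _ _ tendsto_const, rotated 2])
      (use D Delta_le_area_range in \<open>auto intro!: always_eventually less_imp_le\<close>)
  with D(1) show ?thesis by (rule that)
qed

text \<open>Numbering the triangles and ordering their vertices encodes a dissection as a finite
  tuple of points, to which compactness applies.\<close>

lemma dissection_vertices:
  assumes "D \<in> dissections n"
  shows "\<exists>v :: nat \<Rightarrow> (real^2) \<times> (real^2) \<times> (real^2).
    bij_betw (\<lambda>i. convex hull {fst (v i), fst (snd (v i)), snd (snd (v i))}) {..<n} D"
proof -
  have D: "finite D" "card D = n" "\<And>T. T \<in> D \<Longrightarrow> nondegenerate_triangle T"
    using assms by (auto simp: dissections_def)
  obtain F where F: "bij_betw F {..<n} D"
    using ex_bij_betw_nat_finite[OF D(1)] D(2) by (auto simp: lessThan_atLeast0)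
  have "\<forall>i. \<exists>w. i < n \<longrightarrow> F i = convex hull {fst w, fst (snd w), snd (snd w)}"
  proof
    fix i
    have "i < n \<Longrightarrow> nondegenerate_triangle (F i)"
      using D(3) bij_betwE[OF F] by auto
    then show "\<exists>w. i < n \<longrightarrow> F i = convex hull {fst w, fst (snd w), snd (snd w)}"
      unfolding nondegenerate_triangle_def by (metis fst_conv snd_conv)
  qed
  then obtain v where "\<And>i. i < n \<Longrightarrow> F i = convex hull {fst (v i), fst (snd (v i)), snd (snd (v i))}"
    by metis
  then have "bij_betw (\<lambda>i. convex hull {fst (v i), fst (snd (v i)), snd (snd (v i))}) {..<n} D"
    using F by (subst bij_betw_cong[where g = F]) auto
  then show ?thesis
    by (intro exI[of _ v])
qed

section \<open>Attainment of the infimum\<close>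

lemma Delta_attained:
  assumes "dissections n \<noteq> {}"
  shows "\<exists>D\<in>dissections n. area_range D = Delta n"
proof -
  define tri where "tri w = convex hull {fst w, fst (snd w), snd (snd w)}"
    for w :: "(real^2) \<times> (real^2) \<times> (real^2)"
  define K where "K = unit_square \<times> unit_square \<times> unit_square"
  obtain D where D: "\<And>k::nat. D k \<in> dissections n" "(\<lambda>k. area_range (D k)) \<longlonglongrightarrow> Delta n"
    using minimizing_sequence[OF assms] by blast
  have "\<forall>k. \<exists>v. bij_betw (\<lambda>i. tri (v i)) {..<n} (D k)"
    using dissection_vertices[OF D(1)] by (simp add: tri_def)
  then obtain v where v: "\<And>k. bij_betw (\<lambda>i. tri (v k i)) {..<n} (D k)"
    by metis
  have triD: "tri (v k i) \<in> D k" if "i < n" for k i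
    using bij_betwE[OF v] that by blast
  have UD: "\<Union>(D k) = unit_square" for k
    using D(1) by (auto simp: dissections_def)
  have "v k i \<in> K" if "i \<in> {..<n}" for k i
  proof -
    have "tri (v k i) \<subseteq> unit_square"
      using UD triD[of i k] that by blast
    moreover have "{fst (v k i), fst (snd (v k i)), snd (snd (v k i))} \<subseteq> tri (v k i)"
      unfolding tri_def by (rule hull_subset)
    ultimately show ?thesis
      by (auto simp: K_def mem_Times_iff)
  qed
  moreover have "compact K"
    by (simp add: K_def unit_square_def compact_Times)
  ultimately have "\<exists>r w. strict_mono (r :: nat \<Rightarrow> nat) \<and>
      (\<forall>i\<in>{..<n}. w i \<in> K \<and> (\<lambda>k. v (r k) i) \<longlonglongrightarrow> w i)"
    by (intro compact_finite_family_convergent_subseq) auto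
  then obtain r w where r: "strict_mono (r :: nat \<Rightarrow> nat)"
    and rw: "\<forall>i\<in>{..<n}. w i \<in> K \<and> (\<lambda>k. v (r k) i) \<longlonglongrightarrow> w i"
    by blast
  then have w: "w i \<in> K" "(\<lambda>k. v (r k) i) \<longlonglongrightarrow> w i" if "i < n" for i
    using that by simp_all
  define F where "F i = tri (w i)" for i
  have lim_area: "(\<lambda>k. area (tri (v (r k) i))) \<longlonglongrightarrow> area (F i)" if "i < n" for i
    unfolding F_def tri_def
    by (intro tendsto_area_triangle tendsto_fst tendsto_snd w that)
  have lim_range: "(\<lambda>k. area_range (D (r k))) \<longlonglongrightarrow> Delta n"
    using LIMSEQ_subseq_LIMSEQ[OF D(2) r] by (simp add: o_def)
  \<comment> \<open>Differences for fixed indices are continuous in the vertices, so the bound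
    passes to the limit. It includes the indices whose limit triangle is degenerate, which is
    essential below.\<close>
  have diff_le: "area (F i) - area (F j) \<le> Delta n" if "i < n" "j < n" for i j
  proof (rule LIMSEQ_le[OF tendsto_diff[OF lim_area lim_area, OF that] lim_range])
    have "area (tri (v (r k) i)) - area (tri (v (r k) j)) \<le> area_range (D (r k))" for k
      using dissection_finite_nonempty(1)[OF D(1)] triD that by (intro area_diff_le_area_range)
    then show "\<exists>N. \<forall>k\<ge>N. area (tri (v (r k) i)) - area (tri (v (r k) j)) \<le> area_range (D (r k))"
      by blast
  qed
  have "(\<lambda>k. \<Sum>i<n. area (tri (v (r k) i))) \<longlonglongrightarrow> (\<Sum>i<n. area (F i))"
    using lim_area by (intro tendsto_sum) auto
  moreover have "(\<Sum>i<n. area (tri (v k i))) = 1" for k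
    using sum.reindex_bij_betw[OF v, of area] sum_area_dissection[OF D(1)] by simp
  ultimately have sum: "(\<Sum>i<n. area (F i)) = 1"
    by (simp add: LIMSEQ_const_iff)
  define J where "J = {i \<in> {..<n}. 0 < area (F i)}"
  have FJ: "F ` J \<in> dissections (card J)"
    unfolding J_def
  proof (rule dissection_of_cover)
    show "\<exists>a b c. F i = convex hull {a, b, c}" for i
      by (auto simp: F_def tri_def)
    show "F i \<subseteq> unit_square" if "i \<in> {..<n}" for i
      unfolding F_def tri_def using w(1)[of i] that
      by (intro hull_minimal) (auto simp: K_def mem_Times_iff unit_square_def)
    show "unit_square \<subseteq> (\<Union>i\<in>{..<n}. F i)"
    \<comment> \<open>A point missed by all limit triangles would, there being finitely many
      indices, be missed by all triangles of some \<open>D (r k)\<close>, which cover the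
      square.\<close>
    proof (rule subsetI, rule ccontr)
      fix x assume x: "x \<in> unit_square" "x \<notin> (\<Union>i\<in>{..<n}. F i)"
      have "eventually (\<lambda>k. x \<notin> tri (v (r k) i)) sequentially" if "i \<in> {..<n}" for i
        unfolding tri_def
      proof (rule eventually_notin_triangle)
        show "x \<notin> convex hull {fst (w i), fst (snd (w i)), snd (snd (w i))}"
          using x that by (auto simp: F_def tri_def)
        have "(\<lambda>k. v (r k) i) \<longlonglongrightarrow> w i"
          using w that by simp
        then show "(\<lambda>k. fst (v (r k) i)) \<longlonglongrightarrow> fst (w i)"
          "(\<lambda>k. fst (snd (v (r k) i))) \<longlonglongrightarrow> fst (snd (w i))"
          "(\<lambda>k. snd (snd (v (r k) i))) \<longlonglongrightarrow> snd (snd (w i))"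
          by (intro tendsto_fst tendsto_snd; assumption)+
      qed
      then have "eventually (\<lambda>k. \<forall>i\<in>{..<n}. x \<notin> tri (v (r k) i)) sequentially"
        by (intro eventually_ball_finite) auto
      then obtain k where "\<forall>i\<in>{..<n}. x \<notin> tri (v (r k) i)"
        using eventually_happens'[OF sequentially_bot] by blast
      moreover have "x \<in> (\<Union>i\<in>{..<n}. tri (v (r k) i))"
        using x UD bij_betw_imp_surj_on[OF v] by simp
      ultimately show False by blast
    qed
  qed (use sum in auto)
  have "J = {..<n}"
  proof (rule ccontr)
    assume "J \<noteq> {..<n}"
    then obtain j where j: "j < n" "area (F j) = 0"
      using area_nonneg by (force simp: J_def less_le)
    \<comment> \<open>Comparison with the degenerate triangle \<open>F j\<close> of area 0 turns the
      bound on differences into a bound on areas.\<close>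
    have "area T \<le> Delta n" if "T \<in> F ` J" for T
      using that j diff_le[of _ j] by (auto simp: J_def)
    moreover have "card J \<le> n"
      using card_mono[of "{..<n}" J] by (auto simp: J_def)
    ultimately have "\<exists>E\<in>dissections n. \<forall>T\<in>E. area T \<le> Delta n"
      by (intro dissection_refine[OF _ FJ])
    then obtain E where E: "E \<in> dissections n" "\<And>T. T \<in> E \<Longrightarrow> area T \<le> Delta n"
      by blast
    obtain S T where ST: "S \<in> E" "T \<in> E" "area_range E = area S - area T"
      using area_range_attained dissection_finite_nonempty[OF E(1)] by blast
    \<comment> \<open>Strictness comes from here: the smallest area of \<open>E\<close> is positive
      while the largest is at most \<open>Delta n\<close>.\<close>
    have "0 < area T"
      using ST E(1) by (auto simp: dissections_def nondegenerate_triangle_def)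
    then have "area_range E < Delta n"
      using E(2)[OF ST(1)] ST by simp
    then show False
      using Delta_le_area_range[OF E(1)] by simp
  qed
  then have L: "F ` {..<n} \<in> dissections n"
    using FJ by simp
  moreover have "area_range (F ` {..<n}) \<le> Delta n"
  proof -
    obtain S T where "S \<in> F ` {..<n}" "T \<in> F ` {..<n}"
      "area_range (F ` {..<n}) = area S - area T"
      using area_range_attained dissection_finite_nonempty[OF L] by blast
    then show ?thesis
      using diff_le by auto
  qed
  ultimately show ?thesis
    using Delta_le_area_range[OF L] by (auto intro: antisym)
qed

theorem proposition1:
  fixes n :: nat
  assumes "n \<ge> 2"
  shows "(\<exists>D\<^sub>0\<in>dissections n. area_range D\<^sub>0 = Delta n) \<and>
    (Delta n \<in> area_range ` dissections n \<and> (\<forall>D\<in>dissections n. Delta n \<le> area_range D))"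
proof -
  obtain D where D: "D \<in> dissections 2"
    using dissections_2_nonempty by blast
  \<comment> \<open>The largest area of \<open>D\<close> serves as the bound carried by the
    refinement from 2 to \<open>n\<close> triangles; only existence of the refinement is
    wanted.\<close>
  have "area T \<le> Max (area ` D)" if "T \<in> D" for T
    using that dissection_finite_nonempty[OF D] by simp
  then have "dissections n \<noteq> {}"
    using dissection_refine[OF assms D] by blast
  then show ?thesis
    using Delta_attained Delta_le_area_range by (metis image_eqI)
qed

end
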